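(* Let $R=\mathbb{Z}_p$ with $p$ prime, or $R=\mathbb{F}_q[[t]]$ with $q$ a prime power. Let $E$ be a Kakeya set in $R^2$. Then $E$ has Minkowski dimension $2$ (i.e. the limit defining the Minkowski dimension exists and equals $2$).
   Context: For a ring $R$, the line with direction vector $v\in R^n$ through $x\in R^n$ is $\{x+sv : s\in R\}$. A Kakeya set in $R^n$ is a subset of $R^n$ which contains (all the points on) at least one line with each possible direction vector $v \in R^n$. Minkowski dimension: for $E\subset \mathbb{F}_q[[t]]^n$, let $E_k$ be the image of $E$ under the projection $\mathbb{F}_q[[t]]^n\to(\mathbb{F}_q[[t]]/t^k)^n$; the Minkowski dimension of $E$ is $\lim_{k\to\infty}\frac{\log|E_k|}{\log q^k}$, provided the limit exists. For $E\subset\mathbb{Z}_p^n$, let $E_k$ be the image of $E$ in $(\mathbb{Z}/p^k\mathbb{Z})^n$; the Minkowski dimension of $E$ is $\lim_{k\to\infty}\frac{\log|E_k|}{\log p^k}$, provided the limit exists. *)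

theory Defs
  imports
    Complex_Main
    "HOL-Library.Cardinality"
    "HOL-Algebra.Algebraic_Closure_Type"
    "HOL-Algebra.QuotRing"
    "HOL-Number_Theory.Residues"
    "HOL-Computational_Algebra.Formal_Power_Series"
begin

section \<open>Kakeya sets over a ring\<close>

text \<open>\<open>R\<^sup>n\<close>: vectors are functions on \<open>{..<n}\<close>, extended by \<open>undefined\<close>.\<close>

definition vectors :: "('a, 'm) ring_scheme \<Rightarrow> nat \<Rightarrow> (nat \<Rightarrow> 'a) set" where
  "vectors R n = {..<n} \<rightarrow>\<^sub>E carrier R"

definition ring_line ::
    "('a, 'm) ring_scheme \<Rightarrow> nat \<Rightarrow> (nat \<Rightarrow> 'a) \<Rightarrow> (nat \<Rightarrow> 'a) \<Rightarrow> (nat \<Rightarrow> 'a) set" where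
  "ring_line R n x v = {\<lambda>i\<in>{..<n}. x i \<oplus>\<^bsub>R\<^esub> s \<otimes>\<^bsub>R\<^esub> v i | s. s \<in> carrier R}"

definition kakeya_set :: "('a, 'm) ring_scheme \<Rightarrow> nat \<Rightarrow> (nat \<Rightarrow> 'a) set \<Rightarrow> bool" where
  "kakeya_set R n E \<longleftrightarrow>
     E \<subseteq> vectors R n \<and> (\<forall>v\<in>vectors R n. \<exists>x\<in>vectors R n. ring_line R n x v \<subseteq> E)"

section \<open>Minkowski dimension\<close>

text \<open>In the two definitions below, \<open>\<pi> k\<close> is the reduction map from the ring to its \<open>k\<close>-th
  quotient, and \<open>q\<close> is the cardinality of the residue field.\<close>

definition reduction :: "(nat \<Rightarrow> 'a \<Rightarrow> 'b) \<Rightarrow> nat \<Rightarrow> nat \<Rightarrow> (nat \<Rightarrow> 'a) set \<Rightarrow> (nat \<Rightarrow> 'b) set" where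
  "reduction \<pi> n k E = (\<lambda>x. \<lambda>i\<in>{..<n}. \<pi> k (x i)) ` E"

text \<open>The limit exists and equals \<open>d\<close>.\<close>

definition has_minkowski_dim ::
    "(nat \<Rightarrow> 'a \<Rightarrow> 'b) \<Rightarrow> nat \<Rightarrow> nat \<Rightarrow> (nat \<Rightarrow> 'a) set \<Rightarrow> real \<Rightarrow> bool" where
  "has_minkowski_dim \<pi> q n E d \<longleftrightarrow>
     (\<lambda>k. ln (real (card (reduction \<pi> n k E))) / ln (real q ^ k)) \<longlonglongrightarrow> d"

section \<open>The \<open>p\<close>-adic integers\<close>

text \<open>\<open>\<int>\<^sub>p\<close> as the inverse limit of the rings \<open>\<int>/p\<^sup>k\<int>\<close>, whose elements are represented by
  \<open>{0..p\<^sup>k - 1}\<close> as in \<^const>\<open>residue_ring\<close>. The unit is reduced explicitly because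
  the component at \<open>k = 0\<close> lives in the zero ring.\<close>

definition padic_ring :: "nat \<Rightarrow> (nat \<Rightarrow> int) ring" where
  "padic_ring p =
     \<lparr>carrier = {x. \<forall>k. x k \<in> carrier (residue_ring (int p ^ k)) \<and> x (Suc k) mod int p ^ k = x k},
      monoid.mult = \<lambda>x y k. (x k * y k) mod int p ^ k,
      one = \<lambda>k. 1 mod int p ^ k,
      zero = \<lambda>k. 0,
      add = \<lambda>x y k. (x k + y k) mod int p ^ k\<rparr>"

definition padic_proj :: "nat \<Rightarrow> (nat \<Rightarrow> int) \<Rightarrow> int" where
  "padic_proj k x = x k"

lemma padic_carrier_iff:
  assumes "p > 0"
  shows "x \<in> carrier (padic_ring p) \<longleftrightarrow> (\<forall>k. x k mod int p ^ k = x k \<and> x (Suc k) mod int p ^ k = x k)"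
proof -
  have "a \<in> {0..int p ^ k - 1} \<longleftrightarrow> a mod int p ^ k = a" for a k
  proof
    assume "a mod int p ^ k = a"
    moreover have "0 < int p ^ k" using assms by simp
    ultimately show "a \<in> {0..int p ^ k - 1}"
      using pos_mod_bound[of "int p ^ k" a] pos_mod_sign[of "int p ^ k" a] by simp
  qed auto
  then show ?thesis by (simp add: padic_ring_def residue_ring_def)
qed

lemma padic_mod_step: "(a :: int) mod int p ^ Suc k mod int p ^ k = a mod int p ^ k"
  by (simp add: mod_mod_cancel le_imp_power_dvd)

lemma cring_padic_ring:
  assumes "p > 0"
  shows "cring (padic_ring p)"
proof -
  note iff = padic_carrier_iff[OF assms]
  have ops: "monoid.mult (padic_ring p) = (\<lambda>x y k. (x k * y k) mod int p ^ k)"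
    "one (padic_ring p) = (\<lambda>k. 1 mod int p ^ k)"
    "zero (padic_ring p) = (\<lambda>k. 0)"
    "add (padic_ring p) = (\<lambda>x y k. (x k + y k) mod int p ^ k)"
    by (simp_all add: padic_ring_def)
  have closed: "(\<lambda>k. f k mod int p ^ k) \<in> carrier (padic_ring p)"
    if "\<And>k. f (Suc k) mod int p ^ k = f k mod int p ^ k" for f
    unfolding iff using that padic_mod_step by (auto simp del: power_Suc)
  have red: "x k mod int p ^ k = x k" "x (Suc k) mod int p ^ k = x k"
    if "x \<in> carrier (padic_ring p)" for x k
    using that iff by auto
  have add_closed: "x \<oplus>\<^bsub>padic_ring p\<^esub> y \<in> carrier (padic_ring p)"
    if "x \<in> carrier (padic_ring p)" "y \<in> carrier (padic_ring p)" for x y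
    unfolding ops using that by (intro closed) (metis mod_add_eq red)
  have mult_closed: "x \<otimes>\<^bsub>padic_ring p\<^esub> y \<in> carrier (padic_ring p)"
    if "x \<in> carrier (padic_ring p)" "y \<in> carrier (padic_ring p)" for x y
    unfolding ops using that by (intro closed) (metis mod_mult_eq red)
  have zero_closed: "\<zero>\<^bsub>padic_ring p\<^esub> \<in> carrier (padic_ring p)"
    unfolding iff ops by simp
  have one_closed: "\<one>\<^bsub>padic_ring p\<^esub> \<in> carrier (padic_ring p)"
    unfolding ops by (intro closed) simp
  have neg: "\<exists>y\<in>carrier (padic_ring p). y \<oplus>\<^bsub>padic_ring p\<^esub> x = \<zero>\<^bsub>padic_ring p\<^esub>"
    if "x \<in> carrier (padic_ring p)" for x
  proof
    show "(\<lambda>k. (- x k) mod int p ^ k) \<in> carrier (padic_ring p)"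
      using that by (intro closed) (metis mod_minus_eq red)
    show "(\<lambda>k. (- x k) mod int p ^ k) \<oplus>\<^bsub>padic_ring p\<^esub> x = \<zero>\<^bsub>padic_ring p\<^esub>"
      unfolding ops by (simp add: mod_add_left_eq)
  qed
  have grp: "abelian_group (padic_ring p)"
  proof (rule abelian_groupI)
    fix x assume "x \<in> carrier (padic_ring p)"
    then show "\<zero>\<^bsub>padic_ring p\<^esub> \<oplus>\<^bsub>padic_ring p\<^esub> x = x"
      unfolding ops using red by (auto simp: fun_eq_iff)
  qed (use add_closed zero_closed neg in
        \<open>auto simp: ops fun_eq_iff mod_add_left_eq mod_add_right_eq algebra_simps\<close>)
  have mon: "comm_monoid (padic_ring p)"
  proof (rule comm_monoidI)
    fix x assume "x \<in> carrier (padic_ring p)"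
    then show "\<one>\<^bsub>padic_ring p\<^esub> \<otimes>\<^bsub>padic_ring p\<^esub> x = x"
      unfolding ops using red by (auto simp: fun_eq_iff mod_mult_left_eq)
  qed (use mult_closed one_closed in
        \<open>auto simp: ops fun_eq_iff mod_mult_left_eq mod_mult_right_eq algebra_simps\<close>)
  show ?thesis
    by (rule cringI[OF grp mon])
       (auto simp: ops fun_eq_iff mod_mult_left_eq mod_add_eq distrib_right)
qed

section \<open>Formal power series\<close>

text \<open>\<open>\<pi> k\<close> sends a power series to its class in \<open>F[[t]]/(t\<^sup>k)\<close>. A finite field \<open>F\<close> is rendered as
  a type of class \<open>{finite, field}\<close>, whose cardinality is then an arbitrary prime power.\<close>

abbreviation fps_ring :: "'a :: field fps ring" where
  "fps_ring \<equiv> ring_of_type_algebra"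

definition fps_proj :: "nat \<Rightarrow> 'a :: field fps \<Rightarrow> 'a fps set" where
  "fps_proj k f = (PIdl\<^bsub>fps_ring\<^esub> (fps_X ^ k)) +>\<^bsub>fps_ring\<^esub> f"

lemma fps_proj_carrier:
  "fps_proj k f \<in> carrier ((fps_ring :: 'a :: field fps ring) Quot (PIdl\<^bsub>fps_ring\<^esub> (fps_X ^ k)))"
  by (auto simp: fps_proj_def FactRing_def A_RCOSETS_def' ring_of_type_algebra_def)

lemma fps_proj_eq_iff:
  "fps_proj k f = fps_proj k g \<longleftrightarrow> (\<forall>i<k. fps_nth f i = fps_nth g i)"
proof -
  have coset: "fps_proj k f = {h. \<forall>i<k. fps_nth h i = fps_nth f i}" for f :: "'a fps"
  proof (intro Set.set_eqI iffI)
    fix h assume "h \<in> fps_proj k f"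
    then show "h \<in> {h. \<forall>i<k. fps_nth h i = fps_nth f i}"
      by (auto simp: fps_proj_def a_r_coset_def' cgenideal_def ring_of_type_algebra_def
            fps_X_power_mult_right_nth)
  next
    fix h assume "h \<in> {h. \<forall>i<k. fps_nth h i = fps_nth f i}"
    then have "h = fps_shift k (h - f) * fps_X ^ k + f"
      by (auto simp: fps_eq_iff fps_X_power_mult_right_nth)
    then show "h \<in> fps_proj k f"
      by (auto simp: fps_proj_def a_r_coset_def' cgenideal_def ring_of_type_algebra_def)
  qed
  show ?thesis unfolding coset by auto
qed

end

theory Submission
  imports Defs "HOL-Analysis.Convex" "HOL-Real_Asymp.Real_Asymp"
begin

text \<open>This is Cordoba's \<open>L\<^sup>2\<close> argument. Modulo \<open>\<pi>\<^sup>k\<close>, a Kakeya set contains a line \<open>y = a x + b a\<close>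
  for each of the \<open>q\<^sup>k\<close> slopes \<open>a\<close>. If \<open>a - a'\<close> has valuation \<open>j\<close>, the lines of slopes \<open>a\<close> and
  \<open>a'\<close> share at most \<open>q\<^sup>j\<close> points, and at most \<open>q\<^bsup>k-j\<^esup>\<close> slopes \<open>a'\<close> satisfy this. So there are at
  most \<open>(k + 1) q\<^bsup>2k\<^esup>\<close> coincidences between points on the lines, and Cauchy-Schwarz yields
  \<open>q\<^bsup>2k\<^esup> \<le> (k + 1) |E\<^sub>k|\<close>. The factor \<open>k + 1\<close> disappears in the limit.\<close>

section \<open>Auxiliary facts on collisions, divisibility and limits\<close>

text \<open>Cauchy-Schwarz for the fibre sizes \<open>c y\<close> against the constant 1: they sum
  to \<open>card I\<close>, and their squares sum to the number of colliding pairs.\<close>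

lemma card_sq_le_card_image_mult_collisions:
  assumes "finite I"
  shows "(card I)\<^sup>2 \<le> card (g ` I) * card {(i, j) \<in> I \<times> I. g i = g j}"
proof -
  define c where "c y = card {i \<in> I. g i = y}" for y
  have I: "card I = (\<Sum>y\<in>g ` I. c y)"
    unfolding c_def using sum.image_gen[OF assms, of "\<lambda>_. 1 :: nat" g] by simp
  have "card {(i, j) \<in> I \<times> I. g i = g j} = card (\<Union>y\<in>g ` I. {i \<in> I. g i = y} \<times> {i \<in> I. g i = y})"
    by (rule arg_cong[where f = card]) auto
  also have "\<dots> = (\<Sum>y\<in>g ` I. c y * c y)"
    unfolding c_def using assms
    by (subst card_UN_disjoint) (auto simp: card_cartesian_product)
  finally have C: "card {(i, j) \<in> I \<times> I. g i = g j} = (\<Sum>y\<in>g ` I. (c y)\<^sup>2)"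
    by (simp add: power2_eq_square)
  have "(\<Sum>y\<in>g ` I. real (c y) * 1)\<^sup>2 \<le> (\<Sum>y\<in>g ` I. (real (c y))\<^sup>2) * (\<Sum>y\<in>g ` I. 1\<^sup>2)"
    by (rule Cauchy_Schwarz_ineq_sum)
  then have "real ((card I)\<^sup>2) \<le> real (card (g ` I) * card {(i, j) \<in> I \<times> I. g i = g j})"
    unfolding I C by (simp add: mult.commute)
  then show ?thesis
    by (rule of_nat_le_iff[THEN iffD1])
qed

text \<open>Primality puts one factor \<open>\<pi>\<close> into \<open>y\<close>; it cancels from
  both sides in a domain, and the induction continues with the cofactor.\<close>

lemma prime_elem_power_dvd_mult_cancel:
  fixes \<pi> :: "'r :: idom"
  assumes "prime_elem \<pi>" "\<not> \<pi> dvd u" "\<pi> ^ n dvd u * y"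
  shows "\<pi> ^ n dvd y"
  using assms(3)
proof (induction n arbitrary: y)
  case (Suc n)
  have "\<pi> dvd u * y" using Suc.prems by (auto intro: dvd_mult_left)
  then obtain z where z: "y = \<pi> * z"
    using assms by (auto simp: prime_elem_dvd_mult_iff elim: dvdE)
  have "\<pi> * \<pi> ^ n dvd \<pi> * (u * z)" using Suc.prems by (simp add: z algebra_simps)
  then have "\<pi> ^ n dvd u * z" using assms(1) by (simp add: prime_elem_def)
  then have "\<pi> ^ n dvd z" by (rule Suc.IH)
  then show ?case by (simp add: z mult_dvd_mono)
qed simp

text \<open>After taking logarithms, the factor \<open>k + 1\<close> costs only
  \<open>ln (k + 1) / (k * ln q)\<close>, which tends to 0, so the quotient is squeezed to
  2.\<close>

lemma tendsto_ln_quotient_log_loss: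
  fixes c :: "nat \<Rightarrow> nat"
  assumes q: "q > 1"
    and lower: "\<And>k. q ^ (2 * k) \<le> (k + 1) * c k" and upper: "\<And>k. c k \<le> q ^ (2 * k)"
  shows "(\<lambda>k. ln (real (c k)) / ln (real q ^ k)) \<longlonglongrightarrow> 2"
proof (rule tendsto_sandwich)
  have lnq: "ln (real q) > 0" using q by simp
  have pos: "c k > 0" for k
    using lower[of k] q by (cases "c k = 0") auto
  show "\<forall>\<^sub>F k in sequentially. 2 - ln (real (k + 1)) / real k / ln (real q)
      \<le> ln (real (c k)) / ln (real q ^ k)"
    \<comment> \<open>At \<open>k = 0\<close> the denominator is \<open>ln 1 = 0\<close>, the
      quotient is 0 by convention and this lower bound fails.\<close>
    using eventually_gt_at_top[of 0]
  proof eventually_elim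
    case (elim k)
    have "real q ^ (2 * k) \<le> real (k + 1) * real (c k)"
      using of_nat_mono[OF lower[of k], where 'a = real] by (simp add: algebra_simps)
    then have "ln (real q ^ (2 * k)) \<le> ln (real (k + 1) * real (c k))"
      using q by (intro ln_mono) auto
    then have "2 * real k * ln (real q) \<le> ln (real (k + 1)) + ln (real (c k))"
      using q pos[of k] by (simp add: ln_realpow ln_mult)
    then show ?case
      using elim lnq q by (simp add: ln_realpow field_simps)
  qed
  show "\<forall>\<^sub>F k in sequentially. ln (real (c k)) / ln (real q ^ k) \<le> 2"
    using eventually_gt_at_top[of 0]
  proof eventually_elim
    case (elim k)
    have "real (c k) \<le> real (q ^ (2 * k))"
      using upper by (rule of_nat_mono)
    then have "ln (real (c k)) \<le> ln (real q ^ (2 * k))"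
      using q pos[of k] by simp
    then show ?case
      using elim lnq q by (simp add: ln_realpow field_simps)
  qed
  have "(\<lambda>k. ln (real (k + 1)) / real k) \<longlonglongrightarrow> 0"
    by real_asymp
  then have "(\<lambda>k. 2 - ln (real (k + 1)) / real k / ln (real q)) \<longlonglongrightarrow> 2 - 0 / ln (real q)"
    by (intro tendsto_intros) (use lnq in auto)
  then show "(\<lambda>k. 2 - ln (real (k + 1)) / real k / ln (real q)) \<longlonglongrightarrow> 2"
    by simp
qed simp

section \<open>Incidence counting modulo powers of a prime element\<close>

text \<open>The counting sees a ring only through its quotients modulo \<open>\<pi> ^ k\<close>.
  Leaving the values of \<open>red k\<close> abstract covers both integer remainders and cosets of
  power series.\<close>

locale residue_system =
  fixes \<pi> :: "'r :: idom" and q :: nat and red :: "nat \<Rightarrow> 'r \<Rightarrow> 'b"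
  assumes prime: "prime_elem \<pi>" and q_gt_1: "q > 1"
    and red_eq_iff: "red k x = red k y \<longleftrightarrow> \<pi> ^ k dvd x - y"
    and card_range_red: "card (range (red k)) = q ^ k"
begin

lemma finite_range_red: "finite (range (red k))"
  using card_range_red[of k] q_gt_1 by (intro card_ge_0_finite) simp

text \<open>All of \<open>S\<close> lies in one class modulo \<open>\<pi> ^ i\<close>. Subtracting a
  base point \<open>x0\<close> and dividing by \<open>\<pi> ^ i\<close> embeds \<open>S\<close> into
  the \<open>q ^ (k - i)\<close> residues modulo \<open>\<pi> ^ (k - i)\<close>. The bound serves
  for slopes as well as for abscissae.\<close>

lemma card_congruent_le:
  assumes "inj_on (red k) D" "i \<le> k" and S: "S \<subseteq> D" "\<And>x y. x \<in> S \<Longrightarrow> y \<in> S \<Longrightarrow> \<pi> ^ i dvd x - y"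
  shows "finite S" "card S \<le> q ^ (k - i)"
proof -
  have "finite S \<and> card S \<le> q ^ (k - i)"
  proof (cases "S = {}")
    case False
    then obtain x0 where x0: "x0 \<in> S" by auto
    have "\<exists>h. \<forall>x\<in>S. x - x0 = \<pi> ^ i * h x"
      using S(2) x0 by (intro bchoice) (auto elim!: dvdE)
    then obtain h where h: "x - x0 = \<pi> ^ i * h x" if "x \<in> S" for x by blast
    have inj: "inj_on (\<lambda>x. red (k - i) (h x)) S"
    proof (rule inj_onI)
      fix x y assume xy: "x \<in> S" "y \<in> S" "red (k - i) (h x) = red (k - i) (h y)"
      then have "\<pi> ^ (k - i) dvd h x - h y" by (simp add: red_eq_iff)
      then have "\<pi> ^ i * \<pi> ^ (k - i) dvd \<pi> ^ i * (h x - h y)" by (intro mult_dvd_mono) auto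
      moreover have "\<pi> ^ i * (h x - h y) = (x - x0) - (y - x0)"
        unfolding h[OF xy(1)] h[OF xy(2)] by (rule right_diff_distrib)
      ultimately have "\<pi> ^ k dvd x - y"
        using \<open>i \<le> k\<close> by (simp flip: power_add)
      then show "x = y"
        using xy S(1) assms(1) by (auto simp: inj_on_def red_eq_iff)
    qed
    have sub: "(\<lambda>x. red (k - i) (h x)) ` S \<subseteq> range (red (k - i))" by auto
    show ?thesis
      using inj_on_finite[OF inj sub finite_range_red] card_inj_on_le[OF inj sub finite_range_red]
      by (simp add: card_range_red)
  qed simp
  then show "finite S" "card S \<le> q ^ (k - i)" by auto
qed

text \<open>The slopes \<open>a'\<close> are sorted by the valuation \<open>j\<close> of
  \<open>a - a'\<close>. Each of the \<open>k + 1\<close> classes contributes at most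
  \<open>q ^ (k - j)\<close> slopes times \<open>q ^ j\<close> abscissae, that is,
  \<open>q ^ k\<close>.\<close>

lemma card_line_collisions_le:
  assumes inj: "inj_on (red k) D"
  shows "card {(a', x) \<in> D \<times> D. red k (a * x + b a) = red k (a' * x + b a')} \<le> (k + 1) * q ^ k"
    (is "card ?C \<le> _")
proof -
  \<comment> \<open>The alternative \<open>j = k\<close> caps the valuation at \<open>k\<close>:
    slopes congruent to \<open>a\<close> modulo \<open>\<pi> ^ k\<close>, including \<open>a\<close>
    itself, all go into \<open>A k\<close>.\<close>
  define A where "A j = {a' \<in> D. \<pi> ^ j dvd a - a' \<and> (j = k \<or> \<not> \<pi> ^ Suc j dvd a - a')}" for j
  define P where "P a' = {x \<in> D. red k (a * x + b a) = red k (a' * x + b a')}" for a'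
  have cover: "?C \<subseteq> (\<Union>j\<le>k. SIGMA a':A j. P a')"
  proof clarify
    fix a' x assume h: "a' \<in> D" "x \<in> D" "red k (a * x + b a) = red k (a' * x + b a')"
    define j where "j = Max {j. j \<le> k \<and> \<pi> ^ j dvd a - a'}"
    have "j \<in> {j. j \<le> k \<and> \<pi> ^ j dvd a - a'}"
      unfolding j_def by (rule Max_in) (auto intro!: exI[of _ 0])
    moreover have "j = k \<or> \<not> \<pi> ^ Suc j dvd a - a'"
    proof (rule ccontr)
      assume "\<not> (j = k \<or> \<not> \<pi> ^ Suc j dvd a - a')"
      then have "Suc j \<in> {j. j \<le> k \<and> \<pi> ^ j dvd a - a'}"
        using \<open>j \<in> _\<close> by auto
      then have "Suc j \<le> j" unfolding j_def by (intro Max_ge) auto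
      then show False by simp
    qed
    ultimately show "(a', x) \<in> (\<Union>j\<le>k. SIGMA a':A j. P a')"
      using h by (auto simp: A_def P_def)
  qed
  have A: "finite (A j) \<and> card (A j) \<le> q ^ (k - j)" if "j \<le> k" for j
  proof -
    have "\<pi> ^ j dvd x - y" if "x \<in> A j" "y \<in> A j" for x y
      using dvd_diff[of "\<pi> ^ j" "a - y" "a - x"] that by (simp add: A_def)
    then show ?thesis
      using card_congruent_le[OF inj \<open>j \<le> k\<close>, of "A j"] by (auto simp: A_def)
  qed
  have P: "finite (P a') \<and> card (P a') \<le> q ^ j" if "j \<le> k" "a' \<in> A j" for j a'
  proof -
    \<comment> \<open>Subtracting the coincidences at \<open>x\<close> and \<open>y\<close> removes
      the intercepts and leaves \<open>\<pi> ^ k dvd (a - a') * (x - y)\<close>. The factor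
      \<open>a - a'\<close> accounts for exactly \<open>\<pi> ^ j\<close> when \<open>j < k\<close>;
      for \<open>j = k\<close> the claim is about \<open>\<pi> ^ 0\<close>.\<close>
    have "\<pi> ^ (k - j) dvd x - y" if xy: "x \<in> P a'" "y \<in> P a'" for x y
    proof (cases "j = k")
      case False
      obtain u where u: "a - a' = \<pi> ^ j * u" using \<open>a' \<in> A j\<close> by (auto simp: A_def elim!: dvdE)
      have "\<pi> \<noteq> 0" using prime by (simp add: prime_elem_def)
      have "\<not> \<pi> ^ j * \<pi> dvd \<pi> ^ j * u"
        using \<open>a' \<in> A j\<close> False unfolding u[symmetric] by (simp add: A_def mult.commute)
      then have nu: "\<not> \<pi> dvd u" by auto
      have "\<pi> ^ k dvd (a * x + b a - (a' * x + b a')) - (a * y + b a - (a' * y + b a'))"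
        by (rule dvd_diff) (use xy in \<open>auto simp: P_def red_eq_iff\<close>)
      also have "\<dots> = (a - a') * (x - y)" by (simp add: algebra_simps)
      finally have "\<pi> ^ j * \<pi> ^ (k - j) dvd \<pi> ^ j * (u * (x - y))"
        using \<open>j \<le> k\<close> by (simp add: u mult.assoc flip: power_add)
      then have "\<pi> ^ (k - j) dvd u * (x - y)" using \<open>\<pi> \<noteq> 0\<close> by simp
      then show ?thesis by (rule prime_elem_power_dvd_mult_cancel[OF prime nu])
    qed simp
    then show ?thesis
      using card_congruent_le[OF inj, of "k - j" "P a'"] \<open>j \<le> k\<close> by (auto simp: P_def)
  qed
  have "card (SIGMA a':A j. P a') \<le> q ^ k" if "j \<le> k" for j
  proof -
    have "card (SIGMA a':A j. P a') = (\<Sum>a'\<in>A j. card (P a'))"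
      using A P that by (intro card_SigmaI) auto
    also have "\<dots> \<le> card (A j) * q ^ j"
      using sum_bounded_above[of "A j" "\<lambda>a'. card (P a')" "q ^ j"] P that by auto
    also have "\<dots> \<le> q ^ (k - j) * q ^ j" using A that by simp
    also have "\<dots> = q ^ k" using that by (simp flip: power_add)
    finally show ?thesis .
  qed
  then have "(\<Sum>j\<le>k. card (SIGMA a':A j. P a')) \<le> (k + 1) * q ^ k"
    using sum_bounded_above[of "{..k}" "\<lambda>j. card (SIGMA a':A j. P a')" "q ^ k"] by auto
  moreover have "card ?C \<le> card (\<Union>j\<le>k. SIGMA a':A j. P a')"
    using A P by (intro card_mono[OF _ cover]) auto
  moreover have "\<dots> \<le> (\<Sum>j\<le>k. card (SIGMA a':A j. P a'))"
    by (rule card_UN_le) simp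
  ultimately show ?thesis by linarith
qed

text \<open>The collision inequality is applied to the \<open>q ^ (2 * k)\<close> pairs of a slope
  and an abscissa, each mapped by \<open>g\<close> to its point in \<open>F\<close>. At most
  \<open>(k + 1) * q ^ (2 * k)\<close> collisions occur, and dividing by \<open>q ^ (2 * k)\<close>
  gives the bound.\<close>

lemma card_ge_if_contains_lines:
  assumes F: "finite F"
    and lines: "\<And>a. \<exists>x0 x1. \<forall>s. (red k (x0 + s), red k (x1 + s * a)) \<in> F"
  shows "q ^ (2 * k) \<le> (k + 1) * card F"
proof -
  have "\<exists>b. \<forall>x. (red k x, red k (a * x + b)) \<in> F" for a
  proof -
    obtain x0 x1 where h: "(red k (x0 + s), red k (x1 + s * a)) \<in> F" for s using lines by metis
    \<comment> \<open>The parameter \<open>s = x - x0\<close> turns the line with direction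
      \<open>(1, a)\<close> into a graph over the first coordinate, with intercept
      \<open>x1 - x0 * a\<close>.\<close>
    have "(red k x, red k (a * x + (x1 - x0 * a))) \<in> F" for x
      using h[of "x - x0"] by (simp add: algebra_simps)
    then show ?thesis by blast
  qed
  then obtain b where b: "(red k x, red k (a * x + b a)) \<in> F" for a x by metis
  \<comment> \<open>One representative of each residue class modulo \<open>\<pi> ^ k\<close>, used
    both for slopes and for abscissae.\<close>
  define D where "D = inv_into UNIV (red k) ` range (red k)"
  have inj: "inj_on (red k) D"
    unfolding D_def by (rule inj_onI) (auto simp: f_inv_into_f)
  have finD: "finite D" unfolding D_def by (intro finite_imageI finite_range_red)
  have "card D = card (range (red k))"
    unfolding D_def by (rule card_image) (rule inj_on_inv_into, simp)
  then have cardD: "card D = q ^ k" by (simp add: card_range_red)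
  define g where "g = (\<lambda>(a, x). (red k x, red k (a * x + b a)))"
  define C where "C a = {(a', x) \<in> D \<times> D. red k (a * x + b a) = red k (a' * x + b a')}" for a
  \<comment> \<open>Equal points have congruent first coordinates, hence equal abscissae in
    \<open>D\<close>; a collision is thus determined by two slopes and one abscissa.\<close>
  have "{(i, j) \<in> (D \<times> D) \<times> (D \<times> D). g i = g j} \<subseteq> (\<lambda>(a, a', x). ((a, x), (a', x))) ` (SIGMA a:D. C a)"
  proof clarify
    fix a x a' x' assume h: "g (a, x) = g (a', x')" "a \<in> D" "x \<in> D" "a' \<in> D" "x' \<in> D"
    then have "x = x'" using inj by (auto simp: g_def inj_on_def)
    with h show "((a, x), (a', x')) \<in> (\<lambda>(a, a', x). ((a, x), (a', x))) ` (SIGMA a:D. C a)"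
      by (force simp: C_def g_def)
  qed
  moreover have finC: "finite (C a)" for a
    unfolding C_def using finD by (auto intro: finite_subset[of _ "D \<times> D"])
  ultimately have "card {(i, j) \<in> (D \<times> D) \<times> (D \<times> D). g i = g j} \<le> card (SIGMA a:D. C a)"
    using finD by (intro surj_card_le) auto
  also have "\<dots> = (\<Sum>a\<in>D. card (C a))" using finD finC by (intro card_SigmaI) auto
  also have "\<dots> \<le> card D * ((k + 1) * q ^ k)"
    using sum_bounded_above[of D "\<lambda>a. card (C a)" "(k + 1) * q ^ k"]
      card_line_collisions_le[OF inj] by (auto simp: C_def)
  finally have coll: "card {(i, j) \<in> (D \<times> D) \<times> (D \<times> D). g i = g j} \<le> q ^ k * ((k + 1) * q ^ k)"
    by (simp add: cardD)
  have le: "card (g ` (D \<times> D)) \<le> card F" using b by (intro card_mono[OF F]) (auto simp: g_def)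
  have "(card (D \<times> D))\<^sup>2
      \<le> card (g ` (D \<times> D)) * card {(i, j) \<in> (D \<times> D) \<times> (D \<times> D). g i = g j}"
    using finD by (intro card_sq_le_card_image_mult_collisions) simp
  also have "\<dots> \<le> card F * (q ^ k * ((k + 1) * q ^ k))"
    using le coll by (rule mult_le_mono)
  also have "\<dots> = ((k + 1) * card F) * (q ^ k * q ^ k)"
    by (simp only: mult_ac)
  finally have "q ^ (2 * k) * q ^ (2 * k) \<le> ((k + 1) * card F) * q ^ (2 * k)"
    by (simp only: power2_eq_square card_cartesian_product cardD mult_2 power_add)
  then show ?thesis using q_gt_1 by simp
qed

text \<open>Transfers the count to a set \<open>E\<close> over a possibly different ring
  \<open>'a\<close>. Only agreement of \<open>proj k\<close> with \<open>red k\<close> at level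
  \<open>k\<close> is asked for, so \<open>x0\<close> and \<open>x1\<close> may depend on
  \<open>k\<close>.\<close>

lemma has_minkowski_dim_2:
  fixes E :: "(nat \<Rightarrow> 'a) set" and proj :: "nat \<Rightarrow> 'a \<Rightarrow> 'b"
  assumes range: "\<And>k z i. z \<in> E \<Longrightarrow> i < 2 \<Longrightarrow> proj k (z i) \<in> range (red k)"
    and lines: "\<And>k a. \<exists>x0 x1. \<forall>s. \<exists>z\<in>E. proj k (z 0) = red k (x0 + s) \<and> proj k (z 1) = red k (x1 + s * a)"
  shows "has_minkowski_dim proj q 2 E 2"
  unfolding has_minkowski_dim_def
proof (rule tendsto_ln_quotient_log_loss[OF q_gt_1])
  fix k
  let ?V = "{..<2::nat} \<rightarrow>\<^sub>E range (red k)"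
  have sub: "reduction proj 2 k E \<subseteq> ?V"
    unfolding reduction_def by (intro image_subsetI, subst restrict_PiE_iff) (use range in auto)
  have fin: "finite ?V" by (intro finite_PiE finite_range_red) auto
  have "card ?V = q ^ (2 * k)"
    by (simp add: card_PiE card_range_red mult.commute flip: power_mult)
  with card_mono[OF fin sub] show "card (reduction proj 2 k E) \<le> q ^ (2 * k)" by simp
  define F where "F = (\<lambda>f. (f 0, f 1)) ` reduction proj 2 k E"
  have fr: "finite (reduction proj 2 k E)" using sub fin by (rule finite_subset)
  have "q ^ (2 * k) \<le> (k + 1) * card F"
  proof (rule card_ge_if_contains_lines)
    show "finite F" unfolding F_def using fr by simp
    fix a
    obtain x0 x1 where h: "\<exists>z\<in>E. proj k (z 0) = red k (x0 + s) \<and> proj k (z 1) = red k (x1 + s * a)" for s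
      using lines by metis
    have "(red k (x0 + s), red k (x1 + s * a)) \<in> F" for s
      using h[of s] by (force simp: F_def reduction_def image_image)
    then show "\<exists>x0 x1. \<forall>s. (red k (x0 + s), red k (x1 + s * a)) \<in> F" by blast
  qed
  also have "\<dots> \<le> (k + 1) * card (reduction proj 2 k E)"
    unfolding F_def by (intro mult_le_mono2 card_image_le fr)
  finally show "q ^ (2 * k) \<le> (k + 1) * card (reduction proj 2 k E)" .
qed

end

section \<open>Residues of the integers and of power series\<close>

text \<open>The integers stand in for the \<open>p\<close>-adic integers: they have the same
  quotients modulo \<open>p ^ k\<close> and already form a type of class
  \<open>idom\<close>.\<close>

lemma residue_system_int:
  assumes "Factorial_Ring.prime p"
  shows "residue_system (int p) p (\<lambda>k x. x mod int p ^ k)"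
proof
  show "prime_elem (int p)" using assms by (simp add: prime_imp_prime_elem)
  show "p > 1" using assms by (rule prime_gt_1_nat)
  show "x mod int p ^ k = y mod int p ^ k \<longleftrightarrow> int p ^ k dvd x - y" for k x y
    by (rule mod_eq_dvd_iff)
  have "range (\<lambda>x. x mod int p ^ k) = {0..<int p ^ k}" for k
  proof
    show "range (\<lambda>x. x mod int p ^ k) \<subseteq> {0..<int p ^ k}" using \<open>p > 1\<close> by auto
    show "{0..<int p ^ k} \<subseteq> range (\<lambda>x. x mod int p ^ k)"
      by (metis atLeastLessThan_iff mod_pos_pos_trivial rangeI subsetI)
  qed
  then show "card (range (\<lambda>x. x mod int p ^ k)) = p ^ k" for k
    by (simp flip: of_nat_power)
qed

lemma fps_X_power_dvd_iff_nth:
  fixes f :: "'a :: field fps"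
  shows "fps_X ^ k dvd f \<longleftrightarrow> (\<forall>i<k. fps_nth f i = 0)"
proof
  assume "\<forall>i<k. fps_nth f i = 0"
  then have "f = fps_X ^ k * fps_shift k f"
    by (auto simp: fps_eq_iff fps_X_power_mult_nth)
  then show "fps_X ^ k dvd f" by (rule dvdI)
qed (auto simp: fps_X_power_mult_nth elim!: dvdE)

lemma residue_system_fps:
  "residue_system (fps_X :: 'a :: {finite, field} fps) CARD('a) fps_proj"
proof
  have dvd: "fps_X dvd f \<longleftrightarrow> fps_nth f 0 = 0" for f :: "'a fps"
    using fps_X_power_dvd_iff_nth[of 1 f] by simp
  show "prime_elem (fps_X :: 'a fps)"
    by (rule prime_elemI) (auto simp: dvd)
  have "card {0, 1 :: 'a} \<le> CARD('a)" by (rule card_mono) auto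
  then show "CARD('a) > 1" by simp
  show "fps_proj k x = fps_proj k y \<longleftrightarrow> fps_X ^ k dvd x - y" for k and x y :: "'a fps"
    by (simp add: fps_proj_eq_iff fps_X_power_dvd_iff_nth)
  show "card (range (fps_proj k :: 'a fps \<Rightarrow> _)) = CARD('a) ^ k" for k
  proof -
    \<comment> \<open>Residue classes correspond to tuples of \<open>k\<close> coefficients. Outside
      \<open>{..<k}\<close> such a tuple is \<open>undefined\<close>, which affects only
      coefficients invisible modulo \<open>fps_X ^ k\<close>.\<close>
    let ?V = "{..<k} \<rightarrow>\<^sub>E (UNIV :: 'a set)"
    let ?h = "\<lambda>c. fps_proj k (Abs_fps c) :: 'a fps set"
    have "inj_on ?h ?V"
      by (rule inj_onI) (auto simp: fps_proj_eq_iff intro: PiE_ext)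
    moreover have "?h ` ?V = range (fps_proj k)"
    proof (intro subset_antisym subsetI; clarify)
      fix f :: "'a fps"
      show "fps_proj k f \<in> ?h ` ?V"
      proof (rule image_eqI)
        show "fps_proj k f = ?h (restrict (fps_nth f) {..<k})"
          by (simp add: fps_proj_eq_iff)
      qed simp
    qed auto
    ultimately have "card (range (fps_proj k :: 'a fps \<Rightarrow> _)) = card ?V"
      by (metis card_image)
    then show ?thesis by (simp add: card_PiE)
  qed
qed

section \<open>Lines in Kakeya sets over the two rings\<close>

lemma padic_minkowski_dim:
  assumes p: "Factorial_Ring.prime p" and E: "kakeya_set (padic_ring p) 2 E"
  shows "has_minkowski_dim padic_proj p 2 E 2"
proof -
  interpret residue_system "int p" p "\<lambda>k x. x mod int p ^ k"
    using p by (rule residue_system_int)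
  have p0: "p > 0" using q_gt_1 by simp
  note iff = padic_carrier_iff[OF p0]
  \<comment> \<open>The integer \<open>a\<close> as a coherent sequence of residues; both the
    directions \<open>(1, a)\<close> and the parameters \<open>s\<close> enter the
    \<open>p\<close>-adic integers this way.\<close>
  have const: "(\<lambda>k. a mod int p ^ k) \<in> carrier (padic_ring p)" for a
    unfolding iff using padic_mod_step by (auto simp del: power_Suc)
  show ?thesis
  proof (rule has_minkowski_dim_2)
    fix k z and i :: nat assume "z \<in> E" "i < 2"
    then have "z i \<in> carrier (padic_ring p)"
      using E by (auto simp: kakeya_set_def vectors_def)
    then show "padic_proj k (z i) \<in> range (\<lambda>x. x mod int p ^ k)"
      unfolding padic_proj_def iff by (metis rangeI)
  next
    fix k a
    let ?v = "\<lambda>i\<in>{..<2::nat}. \<lambda>k. (if i = 0 then 1 else a) mod int p ^ k"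
    have "?v \<in> vectors (padic_ring p) 2"
      using const by (auto simp: vectors_def)
    then obtain x where x: "ring_line (padic_ring p) 2 x ?v \<subseteq> E"
      using E unfolding kakeya_set_def by blast
    \<comment> \<open>The level-\<open>k\<close> components \<open>x 0 k\<close> and
      \<open>x 1 k\<close> of the base point serve as its integer approximations.\<close>
    have "\<exists>z\<in>E. padic_proj k (z 0) = (x 0 k + s) mod int p ^ k \<and>
        padic_proj k (z 1) = (x 1 k + s * a) mod int p ^ k" for s
    proof
      let ?s = "\<lambda>k. s mod int p ^ k"
      let ?z = "\<lambda>i\<in>{..<2}. x i \<oplus>\<^bsub>padic_ring p\<^esub> ?s \<otimes>\<^bsub>padic_ring p\<^esub> ?v i"
      show "?z \<in> E" using x const unfolding ring_line_def by blast
      show "padic_proj k (?z 0) = (x 0 k + s) mod int p ^ k \<and>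
        padic_proj k (?z 1) = (x 1 k + s * a) mod int p ^ k"
        by (auto simp: padic_proj_def padic_ring_def mod_mult_left_eq mod_mult_right_eq mod_add_right_eq
              intro!: mod_add_cong)
    qed
    then show "\<exists>x0 x1. \<forall>s. \<exists>z\<in>E. padic_proj k (z 0) = (x0 + s) mod int p ^ k \<and>
        padic_proj k (z 1) = (x1 + s * a) mod int p ^ k"
      by blast
  qed
qed

text \<open>Here power series are themselves the ring of the residue system and \<open>proj\<close>
  is \<open>red\<close>, so a line of direction \<open>(1, a)\<close> in \<open>E\<close> is used
  directly, without approximation.\<close>

lemma fps_minkowski_dim:
  fixes E :: "(nat \<Rightarrow> 'a :: {finite, field} fps) set"
  assumes E: "kakeya_set fps_ring 2 E"
  shows "has_minkowski_dim fps_proj CARD('a) 2 E 2"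
proof -
  interpret residue_system "fps_X :: 'a fps" "CARD('a)" fps_proj
    by (rule residue_system_fps)
  show ?thesis
  proof (rule has_minkowski_dim_2)
    fix k and a :: "'a fps"
    let ?v = "\<lambda>i\<in>{..<2::nat}. if i = 0 then 1 else a"
    have "?v \<in> vectors fps_ring 2"
      by (auto simp: vectors_def ring_of_type_algebra_def)
    then obtain x where x: "ring_line fps_ring 2 x ?v \<subseteq> E"
      using E unfolding kakeya_set_def by blast
    have "\<exists>z\<in>E. fps_proj k (z 0) = fps_proj k (x 0 + s) \<and>
        fps_proj k (z 1) = fps_proj k (x 1 + s * a)" for s
    proof
      let ?z = "\<lambda>i\<in>{..<2}. x i + s * ?v i"
      show "?z \<in> E" using x by (auto simp: ring_line_def ring_of_type_algebra_def)
    qed simp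
    then show "\<exists>x0 x1. \<forall>s. \<exists>z\<in>E. fps_proj k (z 0) = fps_proj k (x0 + s) \<and>
        fps_proj k (z 1) = fps_proj k (x1 + s * a)"
      by blast
  qed simp
qed

theorem theorem1p2:
  shows "(\<forall>(p :: nat) (E :: (nat \<Rightarrow> nat \<Rightarrow> int) set).
            Factorial_Ring.prime p \<longrightarrow> kakeya_set (padic_ring p) 2 E \<longrightarrow> has_minkowski_dim padic_proj p 2 E 2)
       \<and> (\<forall>E :: (nat \<Rightarrow> 'a :: {finite, field} fps) set.
            kakeya_set fps_ring 2 E \<longrightarrow> has_minkowski_dim fps_proj CARD('a) 2 E 2)"
  using padic_minkowski_dim fps_minkowski_dim by blast

end
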